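(* Let $\mathbb{M}$ be a strongly regular sequence admitting a nonzero proximate order, let $e,E$ be an associated pair of kernel functions for $\mathbb{M}$-summability, and let $m=(m(p))_{p\ge 0}$ be the associated sequence of moments. Let $n\ge1$ and $A\in\mathbb{C}^{n\times n}$. Let $\{\lambda_j\}_{1\le j\le k}$, for some $1\le k\le n$, be the set of eigenvalues of $A$. Assume that $\lambda_j$ is an eigenvalue of algebraic multiplicity $m_j\ge1$, for every $1\le j\le k$. Then the general solution of the system $\partial_m y=Ay$ can be written in the form $$y(z)=\sum_{j=1}^{k}\sum_{p=1}^{m_j}C_{j,p}\,y_{j,p}(z),$$ where $C_{j,p}$ are arbitrary constants, and $y_{j,p}$ are entire functions determined from the Jordan decomposition of $A$.
   Context: Strongly regular sequence: a sequence $\mathbb{M}=(M_p)_{p\ge0}$ of positive reals with $M_0=1$ such that (lc) $M_p^2\le M_{p-1}M_{p+1}$ for $p\ge1$; (mg) there is $A_1>0$ with $M_{p+q}\le A_1^{p+q}M_pM_q$ for all $p,q\ge0$; (snq) there is $A_2>0$ with $\sum_{q\ge p}\frac{M_q}{(q+1)M_{q+1}}\le A_2\frac{M_p}{M_{p+1}}$ for all $p\ge0$. Put $M(0)=0$, $M(t)=\sup_{p\ge0}\log(t^p/M_p)$ for $t>0$, $\rho(M)=\limsup_{r\to\infty}\max\{0,\log M(r)/\log r\}$, and $\omega(\mathbb{M})=1/\rho(M)$. Nonzero proximate order: a nonnegative $C^1$ function $\rho(t)$ on some $(c,\infty)$ with $\lim_{r\to\infty}\rho(r)=\rho>0$ and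 $\lim_{r\to\infty}r\rho'(r)\ln r=0$. The sequence $\mathbb{M}$ admits the nonzero proximate order $\rho(t)$ if $\log(t)\left(\rho(t)-\frac{\log M(t)}{\log t}\right)$ is bounded for $t$ large. Sectors: $S_d(\theta)=\{z:|\arg(z)-d|<\theta/2\}$ (on the Riemann surface of the logarithm). $D(z_0,r)$ is the open disc. Pair of kernel functions for $\mathbb{M}$-summability ($0<\omega(\mathbb{M})<2$): functions $e,E$ such that (1) $e$ is holomorphic on $S_0(\omega(\mathbb{M})\pi)$; there is $t_0>0$ such that for every $z_0\in S_0(\omega(\mathbb{M})\pi)$ there is $r_0>0$ with $D(z_0,r_0)\subseteq S_0(\omega(\mathbb{M})\pi)$ and $\int_0^{t_0}\sup_{z\in D(z_0,r_0)}|e(t/z)|\frac{dt}{t}<\infty$; and for every $\delta>0$ there are $k_1,k_2>0$ with $|e(z)|\le k_1\exp(-M(|z|/k_2))$ on $S_0(\omega(\mathbb{M})\pi-\delta)$. (2) $e(|z|)\in\mathbb{R}$ for all $z\in S_0(\omega(\mathbb{M})\pi)$. (3) $E$ is entire, there are $k_3,k_4>0$ with $|E(z)|\le k_3\exp(M(|z|/k_4))$ on $\mathbb{C}$, and there is $\beta>0$ such that for all $0<\theta<2\pi-\omega(\mathbb{M})\pi$ and $R>0$ there is $k_5>0$ with $|E(z)|\le k_5|z|^{-\beta}$ for $z\in S_\pi(\theta)$, $|z|\ge R$. (4) $E(z)=\sum_{p\ge0}\frac{z^p}{m(p)}$, where $m(z)=\int_0^\infty t^{z-1}e(t)\,dt$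 for $\mathrm{Re}(z)\ge0$ is continuous there and holomorphic for $\mathrm{Re}(z)>0$. The sequence $m=(m(p))_{p\ge0}$ (of positive reals) is the sequence of moments. If $\mathbb{M}$ admits a nonzero proximate order, such a pair exists. Moment derivative: $\partial_m\left(\sum_{p\ge0}\frac{a_p}{m(p)}z^p\right)=\sum_{p\ge0}\frac{a_{p+1}}{m(p)}z^p$ on $\mathbb{C}[[z]]$, extended to functions holomorphic near $0$ via Taylor expansion at $0$, and to vectors componentwise. In the system $\partial_m y=Ay$, $y=(y_1,\ldots,y_n)^T$ is a vector of unknown functions. *)

theory Defs
  imports
    "HOL-Complex_Analysis.Complex_Analysis"
    "Jordan_Normal_Form.Spectral_Radius"
begin

unbundle no vec_syntax
hide_const (open) Coset.order

definition strongly_regular :: "(nat \<Rightarrow> real) \<Rightarrow> bool" where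
  "strongly_regular M \<longleftrightarrow>
     (\<forall>p. 0 < M p) \<and> M 0 = 1 \<and>
     (\<forall>p\<ge>1. (M p)\<^sup>2 \<le> M (p - 1) * M (p + 1)) \<and>
     (\<exists>A1>0. \<forall>p q. M (p + q) \<le> A1 ^ (p + q) * M p * M q) \<and>
     (\<exists>A2>0. \<forall>p.
        summable (\<lambda>q. M (p + q) / (real (p + q + 1) * M (p + q + 1))) \<and>
        (\<Sum>q. M (p + q) / (real (p + q + 1) * M (p + q + 1))) \<le> A2 * (M p / M (p + 1)))"

text \<open>For a strongly regular sequence the quotients \<open>M (p + 1) / M p\<close> tend to infinity, so the
  set below is bounded above and the real-valued supremum is the genuine one.\<close>

definition assoc_fun :: "(nat \<Rightarrow> real) \<Rightarrow> real \<Rightarrow> real" where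
  "assoc_fun M t = (if t \<le> 0 then 0 else (SUP p. ln (t ^ p / M p)))"

definition growth_order :: "(nat \<Rightarrow> real) \<Rightarrow> ereal" where
  "growth_order M = Limsup at_top (\<lambda>r::real. ereal (max 0 (ln (assoc_fun M r) / ln r)))"

text \<open>The real value is \<open>0\<close> if \<open>1 / growth_order M\<close> is infinite; kernel functions are only
  considered when \<open>omega M\<close> is positive, i.e. when \<open>growth_order M\<close> is positive and finite.\<close>

definition omega :: "(nat \<Rightarrow> real) \<Rightarrow> real" where
  "omega M = real_of_ereal (1 / growth_order M)"

definition nonzero_proximate_order :: "(real \<Rightarrow> real) \<Rightarrow> bool" where
  "nonzero_proximate_order \<rho> \<longleftrightarrow>
     (\<exists>c. (\<forall>t>c. 0 \<le> \<rho> t) \<and> \<rho> C1_differentiable_on {c<..}) \<and>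
     (\<exists>\<rho>0>0. (\<rho> \<longlongrightarrow> \<rho>0) at_top) \<and>
     ((\<lambda>r. r * deriv \<rho> r * ln r) \<longlongrightarrow> 0) at_top"

definition admits_proximate_order :: "(nat \<Rightarrow> real) \<Rightarrow> (real \<Rightarrow> real) \<Rightarrow> bool" where
  "admits_proximate_order M \<rho> \<longleftrightarrow>
     (\<exists>K. eventually (\<lambda>t. \<bar>ln t * (\<rho> t - ln (assoc_fun M t) / ln t)\<bar> \<le> K) at_top)"

text \<open>The projection to the plane of a sector of the Riemann surface of the logarithm. All sectors
  below have opening less than \<open>2 * pi\<close>, so that the projection is injective on them.\<close>

definition sector :: "real \<Rightarrow> real \<Rightarrow> complex set" where
  "sector d \<theta> = {rcis r \<phi> | r \<phi>. 0 < r \<and> \<bar>\<phi> - d\<bar> < \<theta> / 2}"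

definition moment_fun :: "(complex \<Rightarrow> complex) \<Rightarrow> complex \<Rightarrow> complex" where
  "moment_fun e z = (LINT t:{0<..}|lborel. complex_of_real t powr (z - 1) * e (complex_of_real t))"

definition kernel_pair ::
    "(nat \<Rightarrow> real) \<Rightarrow> (complex \<Rightarrow> complex) \<Rightarrow> (complex \<Rightarrow> complex) \<Rightarrow> bool" where
  "kernel_pair M e E \<longleftrightarrow>
     0 < omega M \<and> omega M < 2 \<and>
     e holomorphic_on sector 0 (omega M * pi) \<and>
     (\<exists>t0>0. \<forall>z0 \<in> sector 0 (omega M * pi). \<exists>r0>0.
        ball z0 r0 \<subseteq> sector 0 (omega M * pi) \<and>
        (\<integral>\<^sup>+t\<in>{0<..<t0}.
           (SUP z\<in>ball z0 r0. ennreal (cmod (e (complex_of_real t / z)))) / ennreal t \<partial>lborel) < \<infinity>) \<and>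
     (\<forall>\<delta>>0. \<exists>k1>0. \<exists>k2>0. \<forall>z \<in> sector 0 (omega M * pi - \<delta>).
        cmod (e z) \<le> k1 * exp (- assoc_fun M (cmod z / k2))) \<and>
     (\<forall>z \<in> sector 0 (omega M * pi). e (complex_of_real (cmod z)) \<in> \<real>) \<and>
     E holomorphic_on UNIV \<and>
     (\<exists>k3>0. \<exists>k4>0. \<forall>z. cmod (E z) \<le> k3 * exp (assoc_fun M (cmod z / k4))) \<and>
     (\<exists>\<beta>>0. \<forall>\<theta> R. 0 < \<theta> \<and> \<theta> < 2 * pi - omega M * pi \<and> 0 < R \<longrightarrow>
        (\<exists>k5>0. \<forall>z \<in> sector pi \<theta>. R \<le> cmod z \<longrightarrow> cmod (E z) \<le> k5 * cmod z powr (- \<beta>))) \<and>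
     continuous_on {z. 0 \<le> Re z} (moment_fun e) \<and>
     moment_fun e holomorphic_on {z. 0 < Re z} \<and>
     (\<forall>z. (\<lambda>p. z ^ p / moment_fun e (of_nat p)) sums E z)"

definition is_moment_sequence :: "(complex \<Rightarrow> complex) \<Rightarrow> (nat \<Rightarrow> real) \<Rightarrow> bool" where
  "is_moment_sequence e m \<longleftrightarrow>
     (\<forall>p. 0 < m p \<and> moment_fun e (of_nat p) = complex_of_real (m p))"

text \<open>If the \<open>p\<close>-th coefficient of \<open>F\<close> is written as \<open>a p / m p\<close>, then the \<open>p\<close>-th coefficient of the
  moment derivative is \<open>a (p + 1) / m p\<close>.\<close>

definition moment_deriv :: "(nat \<Rightarrow> real) \<Rightarrow> complex fps \<Rightarrow> complex fps" where
  "moment_deriv m F =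
     Abs_fps (\<lambda>p. complex_of_real (m (p + 1)) * fps_nth F (p + 1) / complex_of_real (m p))"

text \<open>\<open>f\<close> is holomorphic near the origin and its moment derivative is the germ of \<open>g\<close> there.\<close>

definition has_moment_deriv ::
    "(nat \<Rightarrow> real) \<Rightarrow> (complex \<Rightarrow> complex) \<Rightarrow> (complex \<Rightarrow> complex) \<Rightarrow> bool" where
  "has_moment_deriv m f g \<longleftrightarrow>
     (\<exists>F. f has_fps_expansion F \<and> g has_fps_expansion moment_deriv m F)"

definition solves_moment_system ::
    "(nat \<Rightarrow> real) \<Rightarrow> complex mat \<Rightarrow> (complex \<Rightarrow> complex vec) \<Rightarrow> bool" where
  "solves_moment_system m A y \<longleftrightarrow>
     (\<forall>i<dim_row A. has_moment_deriv m (\<lambda>z. vec_index (y z) i) (\<lambda>z. vec_index (A *\<^sub>v y z) i))"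

definition jordan_decomposition ::
    "complex mat \<Rightarrow> (nat \<times> complex) list \<Rightarrow> complex mat \<Rightarrow> complex mat \<Rightarrow> bool" where
  "jordan_decomposition A bs P Q \<longleftrightarrow>
     0 \<notin> fst ` set bs \<and> similar_mat_wit A (jordan_matrix bs) P Q"

text \<open>\<open>kernel_delta m h a z\<close> is the \<open>h\<close>-th derivative of \<open>E (a * z)\<close> with respect to \<open>a\<close>, divided by
  \<open>fact h\<close>, where \<open>E\<close> has the Taylor coefficients \<open>1 / m q\<close>. In particular
  \<open>kernel_delta m 0 a z = E (a * z)\<close>, and the moment derivative with respect to \<open>z\<close> of
  \<open>kernel_delta m (h + 1) a\<close> is \<open>a * kernel_delta m (h + 1) a + kernel_delta m h a\<close>.\<close>

definition kernel_delta :: "(nat \<Rightarrow> real) \<Rightarrow> nat \<Rightarrow> complex \<Rightarrow> complex \<Rightarrow> complex" where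
  "kernel_delta m h a z =
     (\<Sum>q. of_nat (q choose h) * a ^ (q - h) * z ^ q / complex_of_real (m q))"

text \<open>The matrix \<open>E (z * J)\<close> for a Jordan block \<open>J\<close> of size \<open>s\<close> with eigenvalue \<open>a\<close>, respectively
  for a Jordan matrix \<open>J\<close>.\<close>

definition kernel_jordan_block :: "(nat \<Rightarrow> real) \<Rightarrow> complex \<Rightarrow> nat \<Rightarrow> complex \<Rightarrow> complex mat" where
  "kernel_jordan_block m z s a =
     mat s s (\<lambda>(i, j). if i \<le> j then kernel_delta m (j - i) a z else 0)"

definition kernel_jordan_matrix ::
    "(nat \<Rightarrow> real) \<Rightarrow> (nat \<times> complex) list \<Rightarrow> complex \<Rightarrow> complex mat" where
  "kernel_jordan_matrix m bs z =
     diag_block_mat (map (\<lambda>(s, a). kernel_jordan_block m z s a) bs)"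

text \<open>The columns of the Jordan matrix that carry the eigenvalue \<open>a\<close>, in increasing order; there are
  as many of them as the algebraic multiplicity of \<open>a\<close>.\<close>

definition jordan_columns :: "(nat \<times> complex) list \<Rightarrow> complex \<Rightarrow> nat list" where
  "jordan_columns bs a =
     filter (\<lambda>c. jordan_matrix bs $$ (c, c) = a) [0..<dim_col (jordan_matrix bs)]"

text \<open>If the \<open>p\<close>-th column (counted from 1) with eigenvalue \<open>a\<close> is column \<open>c\<close>, at position \<open>l\<close>
  (counted from 0) of its Jordan block, this is the function mapping \<open>z\<close> to the sum over
  \<open>h \<le> l\<close> of \<open>kernel_delta m h a z\<close> times column \<open>c - h\<close> of \<open>P\<close>; the latter columns form a
  Jordan chain.\<close>

definition jordan_solution ::
    "(nat \<Rightarrow> real) \<Rightarrow> (nat \<times> complex) list \<Rightarrow> complex mat \<Rightarrow> complex \<Rightarrow> nat \<Rightarrow> complex \<Rightarrow> complex vec" where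
  "jordan_solution m bs P a p z =
     col (P * kernel_jordan_matrix m bs z) (jordan_columns bs a ! (p - 1))"

end

theory Submission
  imports Defs
begin

text \<open>
  A power series \<open>\<Sum>q. Y q / m q * z ^ q\<close> with vector coefficients solves the moment system
  exactly if \<open>Y (q + 1) = A Y q\<close> for all \<open>q\<close>, because the moment derivative merely shifts the
  sequence \<open>Y\<close>. Hence \<open>Y q = A\<^sup>q v\<close> with \<open>v = Y 0\<close>: a germ of a solution is determined by
  the vector \<open>v\<close>, and the solution is \<open>E (z A) v\<close>, where \<open>E\<close> is the kernel function with Taylor
  coefficients \<open>1 / m q\<close> (\<open>solves_moment_system_iff_coefficients\<close>). Formally this is the
  argument for \<open>y' = A y\<close> with the exponential function replaced by \<open>E\<close>.

  Let \<open>A = P J Q\<close> be a Jordan decomposition, with \<open>Q\<close> the inverse of \<open>P\<close>. Then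
  \<open>E (z A) v = P E (z J) d\<close> with \<open>d = Q v\<close>, and \<open>d\<close> is as arbitrary as \<open>v\<close>. So the
  solutions are the linear combinations of the columns of \<open>P E (z J)\<close>. By the binomial formula for
  the powers of a Jordan block, the entries in the upper triangles of the blocks of
  \<open>E (z J)\<close> are the functions \<open>kernel_delta\<close>
  (\<open>kernel_jordan_matrix_sums\<close>).

  Since the moments are positive and \<open>E\<close> is entire, all entries of \<open>P E (z J)\<close> are entire: the
  coefficients of \<open>kernel_delta\<close> exceed those of \<open>E\<close> in modulus by a factor that grows at most
  geometrically. A solution on a connected open set \<open>U\<close>
  containing the origin therefore agrees on all of \<open>U\<close> with the entire combination that has the same
  Taylor series (\<open>solves_moment_system_iff_combination\<close>).

  It remains to label the columns by eigenvalues. The matrix \<open>J\<close> is upper triangular with the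
  characteristic polynomial of \<open>A\<close>, so each eigenvalue occurs on its diagonal as often as its
  algebraic multiplicity says, and the pairs \<open>(j, p)\<close> enumerate the columns bijectively
  (\<open>bij_betw_jordan_columns\<close>).
\<close>

section \<open>Power series with infinite radius of convergence\<close>

lemma has_fps_expansion_entire:
  fixes f :: "complex \<Rightarrow> complex"
  assumes "\<And>z. (\<lambda>q. c q * z ^ q) sums f z"
  shows "f has_fps_expansion Abs_fps c" and "f holomorphic_on UNIV"
proof -
  show "f has_fps_expansion Abs_fps c"
    by (rule has_fps_expansionI) (simp add: assms)
  have "conv_radius c = \<infinity>"
    using assms by (intro conv_radius_inftyI'') (auto simp: sums_iff)
  then have "eval_fps (Abs_fps c) holomorphic_on UNIV"
    by (intro holomorphic_on_eval_fps) (auto simp: fps_conv_radius_def)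
  moreover have "eval_fps (Abs_fps c) = f"
    using assms by (auto simp: eval_fps_def sums_iff fun_eq_iff)
  ultimately show "f holomorphic_on UNIV" by simp
qed

lemma has_fps_expansion_eq_on_connected:
  fixes f g :: "complex \<Rightarrow> complex"
  assumes "f has_fps_expansion F" and "g has_fps_expansion F"
    and "f holomorphic_on U" and "g holomorphic_on U"
    and "open U" and "connected U" and "0 \<in> U" and "z \<in> U"
  shows "f z = g z"
proof -
  have "(\<lambda>z. f z - g z) has_fps_expansion F - F"
    by (intro has_fps_expansion_diff assms)
  then have "(\<lambda>z. f z - g z) has_fps_expansion 0" by simp
  moreover have "(\<lambda>z. f z - g z) holomorphic_on U"
    by (intro holomorphic_intros assms)
  ultimately have "f z - g z = 0"
    using assms(5-8) by (rule has_fps_expansion_0_analytic_continuation)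
  then show ?thesis by simp
qed

section \<open>Matrix products and powers\<close>

lemma mult_mat_vec_index_sum:
  assumes "B \<in> carrier_mat k n" and "v \<in> carrier_vec n" and "i < k"
  shows "vec_index (B *\<^sub>v v) i = (\<Sum>c<n. B $$ (i, c) * vec_index v c)"
  using assms by (auto simp: scalar_prod_def atLeast0LessThan intro!: sum.cong)

lemma mult_mat_index_sum:
  assumes "B \<in> carrier_mat k n" and "C \<in> carrier_mat n l" and "i < k" and "j < l"
  shows "(B * C) $$ (i, j) = (\<Sum>c<n. B $$ (i, c) * C $$ (c, j))"
  using assms by (auto simp: scalar_prod_def atLeast0LessThan intro!: sum.cong)

lemma pow_mat_Suc_left:
  assumes "A \<in> carrier_mat n n"
  shows "A * A ^\<^sub>m q = A ^\<^sub>m Suc q"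
proof (induction q)
  case (Suc q)
  have "A * A ^\<^sub>m Suc q = (A * A ^\<^sub>m q) * A"
    using assms by (simp add: assoc_mult_mat[of _ n n _ n _ n])
  then show ?case using Suc by simp
qed (use assms in simp)

section \<open>Columns of a Jordan matrix and algebraic multiplicities\<close>

lemma order_prod_list_linear_factors:
  "order a (\<Prod>x\<leftarrow>xs. [:- x, 1:]) = length (filter (\<lambda>x. x = a) (xs :: complex list))"
proof (induction xs)
  case Nil
  then show ?case by (simp add: order_0I)
next
  case (Cons x xs)
  have "(\<Prod>x\<leftarrow>xs. [:- x, 1:]) \<noteq> 0" by (auto simp: prod_list_zero_iff)
  then have nz: "[:- x, 1:] * (\<Prod>x\<leftarrow>xs. [:- x, 1:]) \<noteq> 0" by (metis mult_eq_0_iff one_neq_zero pCons_eq_0_iff)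
  show ?case
    using Cons order_mult[OF nz, of a] by (auto simp: order_linear')
qed

text \<open>The characteristic polynomial of a triangular matrix is the product of the linear factors
  that belong to its diagonal entries, so counting the diagonal entries equal to \<open>a\<close>
  gives the multiplicity of the root \<open>a\<close>.\<close>

lemma length_jordan_columns:
  "length (jordan_columns bs a) = order a (char_poly (jordan_matrix bs))"
proof -
  let ?J = "jordan_matrix bs"
  have "char_poly ?J = (\<Prod>x\<leftarrow>diag_mat ?J. [:- x, 1:])"
    by (rule char_poly_upper_triangular[OF jordan_matrix_carrier])
       (auto intro!: upper_triangularI jordan_matrix_upper_triangular)
  then have "order a (char_poly ?J) = length (filter (\<lambda>x. x = a) (diag_mat ?J))"
    by (simp add: order_prod_list_linear_factors)
  also have "\<dots> = length (jordan_columns bs a)"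
    by (simp add: diag_mat_def jordan_columns_def filter_map o_def)
  finally show ?thesis by simp
qed

lemma set_jordan_columns:
  "set (jordan_columns bs a) =
     {c. c < dim_col (jordan_matrix bs) \<and> jordan_matrix bs $$ (c, c) = a}"
  by (auto simp: jordan_columns_def)

lemma jordan_diagonal_root:
  assumes "c < dim_col (jordan_matrix bs)"
  shows "poly (char_poly (jordan_matrix bs)) (jordan_matrix bs $$ (c, c) :: complex) = 0"
proof -
  have "c \<in> set (jordan_columns bs (jordan_matrix bs $$ (c, c)))"
    using assms by (auto simp: set_jordan_columns)
  then have "order (jordan_matrix bs $$ (c, c)) (char_poly (jordan_matrix bs)) \<noteq> 0"
    by (metis length_jordan_columns length_pos_if_in_set less_numeral_extra(3))
  then show ?thesis using order_root by blast
qed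

text \<open>Each column carries exactly one eigenvalue, so the lists \<open>jordan_columns\<close> for distinct
  eigenvalues are disjoint and together exhaust the columns; the lengths of these lists are the
  multiplicities. The index \<open>p\<close> counts from 1, list positions count from 0.\<close>

lemma bij_betw_jordan_columns:
  assumes inj: "inj_on ev {1..k}"
    and roots: "\<And>a. poly (char_poly (jordan_matrix bs)) a = 0 \<longleftrightarrow> a \<in> ev ` {1..k}"
    and mu: "\<And>j. j \<in> {1..k} \<Longrightarrow> order (ev j) (char_poly (jordan_matrix bs)) = mu j"
  shows "bij_betw (\<lambda>(j, p). jordan_columns bs (ev j) ! (p - 1))
           (SIGMA j:{1..k}. {1..mu j}) {..<dim_col (jordan_matrix bs)}"
    (is "bij_betw ?f ?S ?T")
proof -
  have len: "length (jordan_columns bs (ev j)) = mu j" if "j \<in> {1..k}" for j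
    using mu[OF that] by (simp add: length_jordan_columns)
  have mem: "?f (j, p) \<in> set (jordan_columns bs (ev j))" if "(j, p) \<in> ?S" for j p
    using that len[of j] by auto
  have dist: "distinct (jordan_columns bs a)" for a
    by (simp add: jordan_columns_def)
  show ?thesis
  proof (rule bij_betw_imageI)
    show "inj_on ?f ?S"
    proof (rule inj_onI, clarify)
      fix j p j' p'
      assume jp: "j \<in> {1..k}" "p \<in> {1..mu j}" "j' \<in> {1..k}" "p' \<in> {1..mu j'}"
        and eq: "jordan_columns bs (ev j) ! (p - 1) = jordan_columns bs (ev j') ! (p' - 1)"
      have "ev j = ev j'"
        using mem[of j p] mem[of j' p'] jp eq by (auto simp: set_jordan_columns)
      with inj jp have j: "j = j'" by (auto dest: inj_onD)
      with eq jp len[of j] have "p - 1 = p' - 1"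
        using nth_eq_iff_index_eq[OF dist[of "ev j"], of "p - 1" "p' - 1"] by auto
      with jp j show "j = j' \<and> p = p'" by auto
    qed
    show "?f ` ?S = ?T"
    proof (intro equalityI subsetI)
      fix c assume "c \<in> ?f ` ?S"
      then show "c \<in> ?T" using mem by (auto simp: set_jordan_columns)
    next
      fix c assume c: "c \<in> ?T"
      then obtain j where j: "j \<in> {1..k}" "jordan_matrix bs $$ (c, c) = ev j"
        using jordan_diagonal_root[of c bs] roots by auto
      then have "c \<in> set (jordan_columns bs (ev j))"
        using c by (auto simp: set_jordan_columns)
      then obtain i where i: "i < mu j" "c = jordan_columns bs (ev j) ! i"
        using len[OF j(1)] by (auto simp: in_set_conv_nth)
      then have "(j, Suc i) \<in> ?S" "c = ?f (j, Suc i)" using j by auto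
      then show "c \<in> ?f ` ?S" by blast
    qed
  qed
qed

section \<open>The fundamental matrix\<close>

text \<open>The numbers \<open>1 / m q\<close> are to be the Taylor coefficients of the entire kernel \<open>E\<close>. Convergence
  at the real points suffices for that and is the form needed for majorants.\<close>

locale entire_kernel =
  fixes m :: "nat \<Rightarrow> real"
  assumes moment_pos: "\<And>q. 0 < m q"
    and kernel_summable: "\<And>x::real. summable (\<lambda>q. x ^ q / m q)"
begin

lemma moment_nonzero [simp]: "m q \<noteq> 0"
  using moment_pos[of q] by simp

text \<open>Since \<open>q choose h \<le> 2 ^ q\<close> and \<open>\<bar>a\<bar> ^ (q - h) \<le> (max 1 \<bar>a\<bar>) ^ q\<close>, the series is
  majorized by that of the kernel at the real point \<open>2 * max 1 \<bar>a\<bar> * \<bar>z\<bar>\<close>. The maximum with 1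
  makes the second bound valid for \<open>\<bar>a\<bar> < 1\<close>.\<close>

lemma kernel_delta_sums:
  "(\<lambda>q. of_nat (q choose h) * a ^ (q - h) / complex_of_real (m q) * z ^ q) sums kernel_delta m h a z"
proof -
  let ?b = "max 1 (cmod a)"
  let ?t = "\<lambda>q. of_nat (q choose h) * a ^ (q - h) * z ^ q / complex_of_real (m q)"
  have "cmod (?t q) \<le> (2 * ?b * cmod z) ^ q / m q" for q
  proof -
    have "real (q choose h) \<le> 2 ^ q"
    proof -
      have "q choose h \<le> 2 ^ q"
      proof (cases "h \<le> q")
        case True
        then have "q choose h \<le> (\<Sum>i\<le>q. q choose i)" by (intro member_le_sum) auto
        then show ?thesis by (simp add: choose_row_sum)
      qed (simp add: binomial_eq_0)
      then show ?thesis by (metis of_nat_le_iff of_nat_numeral of_nat_power)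
    qed
    moreover have "cmod a ^ (q - h) \<le> ?b ^ q"
    proof -
      have "cmod a ^ (q - h) \<le> ?b ^ (q - h)" by (intro power_mono) auto
      also have "\<dots> \<le> ?b ^ q" by (intro power_increasing) auto
      finally show ?thesis .
    qed
    ultimately have "real (q choose h) * cmod a ^ (q - h) \<le> 2 ^ q * ?b ^ q"
      by (intro mult_mono) auto
    then have "real (q choose h) * cmod a ^ (q - h) * cmod z ^ q / m q
        \<le> 2 ^ q * ?b ^ q * cmod z ^ q / m q"
      using moment_pos[of q] by (intro divide_right_mono mult_right_mono) auto
    then show ?thesis
      using moment_pos[of q] by (simp add: norm_mult norm_divide norm_power power_mult_distrib)
  qed
  then have "summable ?t"
    by (intro summable_comparison_test'[OF kernel_summable, of 0]) auto
  then have "?t sums kernel_delta m h a z"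
    unfolding kernel_delta_def by (rule summable_sums)
  then show ?thesis by (simp add: mult_ac)
qed

lemma dim_kernel_jordan_matrix [simp]:
  "dim_row (kernel_jordan_matrix m bs z) = sum_list (map fst bs)"
  "dim_col (kernel_jordan_matrix m bs z) = sum_list (map fst bs)"
  by (auto simp: kernel_jordan_matrix_def dim_diag_block_mat kernel_jordan_block_def o_def
      case_prod_beta)

lemma kernel_jordan_block_sums:
  assumes "i < s" and "j < s"
  shows "(\<lambda>q. (jordan_block s a ^\<^sub>m q) $$ (i, j) / complex_of_real (m q) * z ^ q)
    sums (kernel_jordan_block m z s a $$ (i, j))"
proof (cases "i \<le> j")
  case True
  \<comment> \<open>The exponents \<open>q + i - j\<close> and \<open>q - (j - i)\<close> agree because \<open>i \<le> j\<close>, also under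
    truncation.\<close>
  have "(jordan_block s a ^\<^sub>m q) $$ (i, j) = of_nat (q choose (j - i)) * a ^ (q - (j - i))" for q
    using assms True by (simp add: jordan_block_pow)
  then show ?thesis
    using assms True kernel_delta_sums[of "j - i" a z] by (simp add: kernel_jordan_block_def)
qed (use assms in \<open>auto simp: jordan_block_pow kernel_jordan_block_def\<close>)

text \<open>This is the meaning of the kernel matrix: it is \<open>E\<close> evaluated at \<open>z J\<close>. Powers of a
  block-diagonal matrix are taken blockwise, which reduces the claim to single blocks.\<close>

lemma kernel_jordan_matrix_sums:
  assumes "i < sum_list (map fst bs)" and "j < sum_list (map fst bs)"
  shows "(\<lambda>q. (jordan_matrix bs ^\<^sub>m q) $$ (i, j) / complex_of_real (m q) * z ^ q)
    sums (kernel_jordan_matrix m bs z $$ (i, j))"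
  using assms
proof (induction bs arbitrary: i j)
  case Nil
  then show ?case by simp
next
  case (Cons b bs)
  obtain s a where b: "b = (s, a)" by (cases b)
  let ?N = "sum_list (map fst bs)"
  have K: "kernel_jordan_matrix m (b # bs) z =
      four_block_mat (kernel_jordan_block m z s a) (0\<^sub>m s ?N) (0\<^sub>m ?N s) (kernel_jordan_matrix m bs z)"
    using dim_kernel_jordan_matrix[of bs z]
    by (simp add: b kernel_jordan_matrix_def Let_def kernel_jordan_block_def)
  have dims: "dim_row (jordan_matrix bs ^\<^sub>m q) = ?N" "dim_col (jordan_matrix bs ^\<^sub>m q) = ?N" for q
    using pow_carrier_mat[OF jordan_matrix_carrier[of bs], of q] by auto
  have J: "jordan_matrix (b # bs) ^\<^sub>m q =
      four_block_mat (jordan_block s a ^\<^sub>m q) (0\<^sub>m s ?N) (0\<^sub>m ?N s) (jordan_matrix bs ^\<^sub>m q)" for q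
    using dims[of q] by (simp add: b jordan_matrix_pow Let_def)
  have kdims: "dim_row (kernel_jordan_block m z s a) = s" "dim_col (kernel_jordan_block m z s a) = s"
    by (auto simp: kernel_jordan_block_def)
  show ?case
    using Cons.prems Cons.IH[of "i - s" "j - s"] kernel_jordan_block_sums[of i s j a z]
    unfolding K J by (auto simp: b dims kdims simp del: pow_mat_dim)
qed

lemma fundamental_matrix_sums:
  assumes "P \<in> carrier_mat k n" and "n = sum_list (map fst bs)" and "i < k" and "c < n"
  shows "(\<lambda>q. (P * jordan_matrix bs ^\<^sub>m q) $$ (i, c) / complex_of_real (m q) * z ^ q)
    sums ((P * kernel_jordan_matrix m bs z) $$ (i, c))"
proof -
  have J: "jordan_matrix bs ^\<^sub>m q \<in> carrier_mat n n" for q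
    using assms(2) by (metis jordan_matrix_carrier pow_carrier_mat)
  have K: "kernel_jordan_matrix m bs z \<in> carrier_mat n n"
    using assms(2) by (intro carrier_matI) auto
  have "(\<lambda>q. \<Sum>l<n. P $$ (i, l) * ((jordan_matrix bs ^\<^sub>m q) $$ (l, c) / complex_of_real (m q) * z ^ q))
    sums (\<Sum>l<n. P $$ (i, l) * kernel_jordan_matrix m bs z $$ (l, c))"
    using assms by (intro sums_sum sums_mult kernel_jordan_matrix_sums) auto
  then show ?thesis
    using assms
    by (simp add: mult_mat_index_sum[OF assms(1) J] mult_mat_index_sum[OF assms(1) K]
        sum_distrib_right sum_divide_distrib mult.assoc del: index_mult_mat(1))
qed

text \<open>The combination with coefficient vector \<open>d\<close> is \<open>P E (z J) d\<close>, which equals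
  \<open>E (z A) (P d)\<close> because \<open>A\<^sup>q P = P J\<^sup>q\<close>.\<close>

lemma fundamental_matrix_combination:
  assumes A: "A \<in> carrier_mat n n"
    and wit: "similar_mat_wit A (jordan_matrix bs) P Q" and i: "i < n"
  shows "(\<lambda>z. \<Sum>c<n. d c * (P * kernel_jordan_matrix m bs z) $$ (i, c)) has_fps_expansion
      Abs_fps (\<lambda>q. vec_index (A ^\<^sub>m q *\<^sub>v (P *\<^sub>v vec n d)) i / complex_of_real (m q))"
    and "(\<lambda>z. \<Sum>c<n. d c * (P * kernel_jordan_matrix m bs z) $$ (i, c)) holomorphic_on UNIV"
proof -
  note w = similar_mat_witD2[OF A wit]
  have n: "n = sum_list (map fst bs)" using w(5) by auto
  let ?J = "jordan_matrix bs"
  have J: "?J ^\<^sub>m q \<in> carrier_mat n n" for q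
    using w(5) by (rule pow_carrier_mat)
  have Aq: "A ^\<^sub>m q *\<^sub>v (P *\<^sub>v vec n d) = (P * ?J ^\<^sub>m q) *\<^sub>v vec n d" for q
  proof -
    have "A ^\<^sub>m q *\<^sub>v (P *\<^sub>v vec n d) = (A ^\<^sub>m q * P) *\<^sub>v vec n d"
      using w A by (intro assoc_mult_mat_vec[symmetric]) auto
    also have "A ^\<^sub>m q * P = P * ?J ^\<^sub>m q * Q * P"
      using similar_mat_wit_pow_id[OF wit] by simp
    also have "\<dots> = P * ?J ^\<^sub>m q * (Q * P)"
      using w(6,7) J by (intro assoc_mult_mat[of _ n n _ n _ n]) auto
    also have "\<dots> = P * ?J ^\<^sub>m q"
      using w J by (simp add: right_mult_one_mat[of _ n n])
    finally show ?thesis .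
  qed
  have sums: "(\<lambda>q. vec_index (A ^\<^sub>m q *\<^sub>v (P *\<^sub>v vec n d)) i / complex_of_real (m q) * z ^ q)
    sums (\<Sum>c<n. d c * (P * kernel_jordan_matrix m bs z) $$ (i, c))" for z
  proof -
    have "(\<lambda>q. \<Sum>c<n. d c * ((P * ?J ^\<^sub>m q) $$ (i, c) / complex_of_real (m q) * z ^ q))
      sums (\<Sum>c<n. d c * (P * kernel_jordan_matrix m bs z) $$ (i, c))"
      using i by (intro sums_sum sums_mult fundamental_matrix_sums[OF w(6) n]) auto
    moreover have "vec_index (A ^\<^sub>m q *\<^sub>v (P *\<^sub>v vec n d)) i
        = (\<Sum>c<n. (P * ?J ^\<^sub>m q) $$ (i, c) * d c)" for q
      unfolding Aq using mult_mat_vec_index_sum[OF mult_carrier_mat[OF w(6) J] vec_carrier i] by simp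
    then have "vec_index (A ^\<^sub>m q *\<^sub>v (P *\<^sub>v vec n d)) i / complex_of_real (m q) * z ^ q
        = (\<Sum>c<n. d c * ((P * ?J ^\<^sub>m q) $$ (i, c) / complex_of_real (m q) * z ^ q))" for q
      by (simp add: sum_distrib_left sum_distrib_right sum_divide_distrib mult_ac)
    ultimately show ?thesis by simp
  qed
  show "(\<lambda>z. \<Sum>c<n. d c * (P * kernel_jordan_matrix m bs z) $$ (i, c)) has_fps_expansion
      Abs_fps (\<lambda>q. vec_index (A ^\<^sub>m q *\<^sub>v (P *\<^sub>v vec n d)) i / complex_of_real (m q))"
    and "(\<lambda>z. \<Sum>c<n. d c * (P * kernel_jordan_matrix m bs z) $$ (i, c)) holomorphic_on UNIV"
    using has_fps_expansion_entire[OF sums] by auto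
qed

section \<open>Solutions of the moment system\<close>

lemma mult_mat_vec_has_fps_expansion:
  assumes "A \<in> carrier_mat k n" and "\<forall>\<^sub>F z in nhds 0. y z \<in> carrier_vec n"
    and "\<And>j. j < n \<Longrightarrow> (\<lambda>z. vec_index (y z) j) has_fps_expansion F j" and "i < k"
  shows "(\<lambda>z. vec_index (A *\<^sub>v y z) i) has_fps_expansion
    (\<Sum>j<n. fps_const (A $$ (i, j) :: complex) * F j)"
proof -
  have "(\<lambda>z. \<Sum>j<n. A $$ (i, j) * vec_index (y z) j) has_fps_expansion
    (\<Sum>j<n. fps_const (A $$ (i, j)) * F j)"
    using assms(3) by (intro has_fps_expansion_sum has_fps_expansion_cmult_left) auto
  moreover have "\<forall>\<^sub>F z in nhds 0. vec_index (A *\<^sub>v y z) i = (\<Sum>j<n. A $$ (i, j) * vec_index (y z) j)"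
    using assms(2) by eventually_elim (rule mult_mat_vec_index_sum[OF assms(1) _ assms(4)])
  ultimately show ?thesis
    by (subst has_fps_expansion_cong[OF _ refl]) auto
qed

text \<open>In terms of \<open>Y q = m q * F q\<close>, where \<open>F q\<close> is the vector of the \<open>q\<close>-th Taylor
  coefficients, the system becomes the recursion \<open>Y (q + 1) = A Y q\<close> by comparison of
  coefficients.\<close>

lemma solves_moment_system_iff_coefficients:
  assumes A: "A \<in> carrier_mat n n" and y: "\<forall>\<^sub>F z in nhds 0. y z \<in> carrier_vec n"
  shows "solves_moment_system m A y \<longleftrightarrow>
    (\<exists>v\<in>carrier_vec n. \<forall>i<n. (\<lambda>z. vec_index (y z) i) has_fps_expansion
       Abs_fps (\<lambda>q. vec_index (A ^\<^sub>m q *\<^sub>v v) i / complex_of_real (m q)))"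
proof
  assume "solves_moment_system m A y"
  then have "\<forall>i. \<exists>F. i < n \<longrightarrow> (\<lambda>z. vec_index (y z) i) has_fps_expansion F \<and>
      (\<lambda>z. vec_index (A *\<^sub>v y z) i) has_fps_expansion moment_deriv m F"
    using A by (auto simp: solves_moment_system_def has_moment_deriv_def)
  then obtain F where F: "\<And>i. i < n \<Longrightarrow> (\<lambda>z. vec_index (y z) i) has_fps_expansion F i"
    and AF: "\<And>i. i < n \<Longrightarrow> (\<lambda>z. vec_index (A *\<^sub>v y z) i) has_fps_expansion moment_deriv m (F i)"
    by metis
  define Y where "Y q = vec n (\<lambda>i. complex_of_real (m q) * fps_nth (F i) q)" for q
  have Y: "Y q \<in> carrier_vec n" for q by (simp add: Y_def)
  have rec: "Y (Suc q) = A *\<^sub>v Y q" for q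
  proof (rule eq_vecI)
    show "dim_vec (Y (Suc q)) = dim_vec (A *\<^sub>v Y q)" using A by (simp add: Y_def)
    fix i assume "i < dim_vec (A *\<^sub>v Y q)"
    then have i: "i < n" using A by simp
    have "moment_deriv m (F i) = (\<Sum>j<n. fps_const (A $$ (i, j)) * F j)"
      using AF[OF i] mult_mat_vec_has_fps_expansion[OF A y F i]
      by (rule fps_expansion_unique_complex)
    then have "fps_nth (moment_deriv m (F i)) q = (\<Sum>j<n. A $$ (i, j) * fps_nth (F j) q)"
      by (simp add: fps_sum_nth)
    then have "complex_of_real (m (Suc q)) * fps_nth (F i) (Suc q)
        = complex_of_real (m q) * (\<Sum>j<n. A $$ (i, j) * fps_nth (F j) q)"
      by (simp add: moment_deriv_def divide_eq_eq mult.commute)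
    then show "vec_index (Y (Suc q)) i = vec_index (A *\<^sub>v Y q) i"
      using i by (simp add: mult_mat_vec_index_sum[OF A Y i], simp add: Y_def sum_distrib_left mult_ac)
  qed
  have pow: "Y q = A ^\<^sub>m q *\<^sub>v Y 0" for q
  proof (induction q)
    case 0
    show ?case using A Y by simp
  next
    case (Suc q)
    have "Y (Suc q) = A *\<^sub>v (A ^\<^sub>m q *\<^sub>v Y 0)" using rec Suc by simp
    also have "\<dots> = (A * A ^\<^sub>m q) *\<^sub>v Y 0"
      using assoc_mult_mat_vec[OF A pow_carrier_mat[OF A] Y] by simp
    also have "A * A ^\<^sub>m q = A ^\<^sub>m Suc q" using pow_mat_Suc_left[OF A] by simp
    finally show ?case .
  qed
  have "(\<lambda>z. vec_index (y z) i) has_fps_expansion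
      Abs_fps (\<lambda>q. vec_index (A ^\<^sub>m q *\<^sub>v Y 0) i / complex_of_real (m q))" if i: "i < n" for i
  proof -
    have "F i = Abs_fps (\<lambda>q. vec_index (Y q) i / complex_of_real (m q))"
      using i by (simp add: Y_def fps_eq_iff)
    then show ?thesis using F[OF i] by (simp flip: pow)
  qed
  with Y show "\<exists>v\<in>carrier_vec n. \<forall>i<n. (\<lambda>z. vec_index (y z) i) has_fps_expansion
       Abs_fps (\<lambda>q. vec_index (A ^\<^sub>m q *\<^sub>v v) i / complex_of_real (m q))"
    by blast
next
  assume "\<exists>v\<in>carrier_vec n. \<forall>i<n. (\<lambda>z. vec_index (y z) i) has_fps_expansion
       Abs_fps (\<lambda>q. vec_index (A ^\<^sub>m q *\<^sub>v v) i / complex_of_real (m q))"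
  then obtain v where v: "v \<in> carrier_vec n"
    and F: "\<And>i. i < n \<Longrightarrow> (\<lambda>z. vec_index (y z) i) has_fps_expansion
       Abs_fps (\<lambda>q. vec_index (A ^\<^sub>m q *\<^sub>v v) i / complex_of_real (m q))" by blast
  have shift: "moment_deriv m (Abs_fps (\<lambda>q. vec_index (A ^\<^sub>m q *\<^sub>v v) i / complex_of_real (m q))) =
    (\<Sum>j<n. fps_const (A $$ (i, j)) * Abs_fps (\<lambda>q. vec_index (A ^\<^sub>m q *\<^sub>v v) j / complex_of_real (m q)))"
    if i: "i < n" for i
  proof (rule fps_ext)
    fix q
    have pv: "A ^\<^sub>m q *\<^sub>v v \<in> carrier_vec n"
      by (rule mult_mat_vec_carrier[OF pow_carrier_mat[OF A] v])
    have "A ^\<^sub>m Suc q *\<^sub>v v = (A * A ^\<^sub>m q) *\<^sub>v v" using pow_mat_Suc_left[OF A] by simp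
    also have "\<dots> = A *\<^sub>v (A ^\<^sub>m q *\<^sub>v v)"
      by (rule assoc_mult_mat_vec[OF A pow_carrier_mat[OF A] v])
    finally have "vec_index (A ^\<^sub>m Suc q *\<^sub>v v) i = (\<Sum>j<n. A $$ (i, j) * vec_index (A ^\<^sub>m q *\<^sub>v v) j)"
      using mult_mat_vec_index_sum[OF A pv i] by simp
    then show "fps_nth (moment_deriv m (Abs_fps (\<lambda>q. vec_index (A ^\<^sub>m q *\<^sub>v v) i / complex_of_real (m q)))) q =
      fps_nth (\<Sum>j<n. fps_const (A $$ (i, j)) *
        Abs_fps (\<lambda>q. vec_index (A ^\<^sub>m q *\<^sub>v v) j / complex_of_real (m q))) q"
      by (simp add: moment_deriv_def fps_sum_nth sum_divide_distrib del: pow_mat.simps)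
  qed
  show "solves_moment_system m A y"
    unfolding solves_moment_system_def has_moment_deriv_def
  proof (intro allI impI exI conjI)
    fix i assume "i < dim_row A"
    then have i: "i < n" using A by simp
    show "(\<lambda>z. vec_index (y z) i) has_fps_expansion
        Abs_fps (\<lambda>q. vec_index (A ^\<^sub>m q *\<^sub>v v) i / complex_of_real (m q))"
      by (rule F[OF i])
    show "(\<lambda>z. vec_index (A *\<^sub>v y z) i) has_fps_expansion moment_deriv m
        (Abs_fps (\<lambda>q. vec_index (A ^\<^sub>m q *\<^sub>v v) i / complex_of_real (m q)))"
      unfolding shift[OF i] by (rule mult_mat_vec_has_fps_expansion[OF A y F i])
  qed
qed

text \<open>The germ of a solution at the origin has an initial vector \<open>v\<close>, and \<open>d = Q v\<close> is the
  coefficient vector with \<open>P d = v\<close>. The identity theorem carries the resulting equality of germs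
  to all of \<open>U\<close>; this is where connectedness enters.\<close>

theorem solves_moment_system_iff_combination:
  assumes A: "A \<in> carrier_mat n n"
    and wit: "similar_mat_wit A (jordan_matrix bs) P Q"
    and U: "open U" "connected U" "0 \<in> U"
    and y: "\<forall>z\<in>U. y z \<in> carrier_vec n"
    and hol: "\<forall>i<n. (\<lambda>z. vec_index (y z) i) holomorphic_on U"
  shows "solves_moment_system m A y \<longleftrightarrow>
    (\<exists>d. \<forall>z\<in>U. \<forall>i<n. vec_index (y z) i =
       (\<Sum>c<n. d c * (P * kernel_jordan_matrix m bs z) $$ (i, c)))"
    (is "_ \<longleftrightarrow> (\<exists>d. \<forall>z\<in>U. \<forall>i<n. _ = ?g d i z)")
proof -
  note w = similar_mat_witD2[OF A wit]
  note comb = fundamental_matrix_combination[OF A wit]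
  have ev_U: "\<forall>\<^sub>F z in nhds 0. z \<in> U" using U by (intro eventually_nhds_in_open)
  then have "\<forall>\<^sub>F z in nhds 0. y z \<in> carrier_vec n"
    by eventually_elim (use y in blast)
  note iff = solves_moment_system_iff_coefficients[OF A this]
  show ?thesis
  proof
    assume "solves_moment_system m A y"
    then obtain v where v: "v \<in> carrier_vec n"
      and F: "\<And>i. i < n \<Longrightarrow> (\<lambda>z. vec_index (y z) i) has_fps_expansion
         Abs_fps (\<lambda>q. vec_index (A ^\<^sub>m q *\<^sub>v v) i / complex_of_real (m q))"
      unfolding iff by blast
    define d where "d = vec_index (Q *\<^sub>v v)"
    have "vec n d = Q *\<^sub>v v" using w(7) by (auto simp: d_def)
    then have "P *\<^sub>v vec n d = (P * Q) *\<^sub>v v"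
      using assoc_mult_mat_vec[OF w(6,7) v] by simp
    also have "\<dots> = v" using w(1) v by simp
    finally have Pd: "P *\<^sub>v vec n d = v" .
    have "vec_index (y z) i = ?g d i z" if "z \<in> U" "i < n" for z i
    proof (rule has_fps_expansion_eq_on_connected[OF F[OF that(2)] _ _ _ U that(1)])
      show "?g d i has_fps_expansion Abs_fps (\<lambda>q. vec_index (A ^\<^sub>m q *\<^sub>v v) i / complex_of_real (m q))"
        using comb(1)[OF that(2), of d] unfolding Pd .
      show "(\<lambda>z. vec_index (y z) i) holomorphic_on U" using hol that(2) by blast
      show "?g d i holomorphic_on U"
        using comb(2)[OF that(2)] by (rule holomorphic_on_subset) simp
    qed
    then show "\<exists>d. \<forall>z\<in>U. \<forall>i<n. vec_index (y z) i = ?g d i z" by blast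
  next
    assume "\<exists>d. \<forall>z\<in>U. \<forall>i<n. vec_index (y z) i = ?g d i z"
    then obtain d where d: "\<And>z i. z \<in> U \<Longrightarrow> i < n \<Longrightarrow> vec_index (y z) i = ?g d i z" by blast
    have "(\<lambda>z. vec_index (y z) i) has_fps_expansion
       Abs_fps (\<lambda>q. vec_index (A ^\<^sub>m q *\<^sub>v (P *\<^sub>v vec n d)) i / complex_of_real (m q))" if i: "i < n" for i
    proof -
      have "\<forall>\<^sub>F z in nhds 0. vec_index (y z) i = ?g d i z"
        using ev_U by eventually_elim (rule d[OF _ i])
      then show ?thesis using comb(1)[OF i] by (subst has_fps_expansion_cong[OF _ refl])
    qed
    moreover have "P *\<^sub>v vec n d \<in> carrier_vec n" using w by simp
    ultimately show "solves_moment_system m A y" unfolding iff by blast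
  qed
qed

lemma fundamental_matrix_entry_holomorphic:
  assumes "P \<in> carrier_mat k n" and "n = sum_list (map fst bs)" and "i < k" and "c < n"
  shows "(\<lambda>z. (P * kernel_jordan_matrix m bs z) $$ (i, c)) holomorphic_on UNIV"
  using has_fps_expansion_entire(2)[OF fundamental_matrix_sums[OF assms]] .

end

section \<open>The general solution\<close>

lemma kernel_pair_imp_entire_kernel:
  assumes "kernel_pair M e E" and "is_moment_sequence e m"
  shows "entire_kernel m"
proof
  show "0 < m q" for q using assms(2) by (simp add: is_moment_sequence_def)
  show "summable (\<lambda>q. x ^ q / m q)" for x :: real
  proof -
    have "summable (\<lambda>p. complex_of_real x ^ p / moment_fun e (of_nat p))"
      using assms(1) by (auto simp: kernel_pair_def sums_iff)
    moreover have "moment_fun e (of_nat p) = complex_of_real (m p)" for p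
      using assms(2) by (simp add: is_moment_sequence_def)
    ultimately have "summable (\<lambda>p. complex_of_real (x ^ p / m p))" by simp
    then show ?thesis by (simp only: summable_complex_of_real)
  qed
qed

lemma jordan_decomposition_exists:
  assumes "A \<in> carrier_mat n n"
  shows "\<exists>bs P Q. jordan_decomposition A bs P Q"
proof -
  obtain as where "char_poly A = (\<Prod>a\<leftarrow>as. [:- a, 1:])"
    using char_poly_factorized[OF assms] by blast
  then obtain bs where "jordan_nf A bs" using jordan_nf_exists[OF assms] by blast
  then show ?thesis
    by (auto simp: jordan_nf_def jordan_decomposition_def similar_mat_def)
qed

text \<open>Passing from \<open>d\<close> to \<open>C\<close> is composition with \<open>f\<close>; the converse needs \<open>f\<close> to be
  injective, so that coefficients \<open>C j p\<close> can be prescribed independently.\<close>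

lemma ex_coefficients_reindex:
  fixes f :: "nat \<times> nat \<Rightarrow> nat" and g :: "'b \<Rightarrow> nat \<Rightarrow> nat \<Rightarrow> 'a::comm_semiring_0"
  assumes bij: "bij_betw f (SIGMA j:{1..k}. {1..mu j}) {..<n}"
  shows "(\<exists>d :: nat \<Rightarrow> 'a. \<forall>x\<in>X. \<forall>i<l. y x i = (\<Sum>c<n. d c * g x i c)) \<longleftrightarrow>
    (\<exists>C. \<forall>x\<in>X. \<forall>i<l. y x i = (\<Sum>j=1..k. \<Sum>p=1..mu j. C j p * g x i (f (j, p))))"
    (is "?L \<longleftrightarrow> ?R")
proof -
  let ?S = "SIGMA j:{1..k}. {1..mu j}"
  have reindex: "(\<Sum>c<n. h c) = (\<Sum>j=1..k. \<Sum>p=1..mu j. h (f (j, p)))" for h :: "nat \<Rightarrow> 'a"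
    using sum.reindex_bij_betw[OF bij, of h] by (subst sum.Sigma) (simp_all add: split_def)
  show ?thesis
  proof
    assume ?L
    then obtain d where "\<forall>x\<in>X. \<forall>i<l. y x i = (\<Sum>c<n. d c * g x i c)" by blast
    then show ?R unfolding reindex by (intro exI[of _ "\<lambda>j p. d (f (j, p))"])
  next
    assume ?R
    then obtain C where C: "\<forall>x\<in>X. \<forall>i<l. y x i = (\<Sum>j=1..k. \<Sum>p=1..mu j. C j p * g x i (f (j, p)))"
      by blast
    define d where "d c = case_prod C (the_inv_into ?S f c)" for c
    have "d (f (j, p)) = C j p" if "j \<in> {1..k}" "p \<in> {1..mu j}" for j p
      using the_inv_into_f_f[OF bij_betw_imp_inj_on[OF bij], of "(j, p)"] that
      by (simp add: d_def)
    then have "\<forall>x\<in>X. \<forall>i<l. y x i = (\<Sum>c<n. d c * g x i c)"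
      using C unfolding reindex by (auto intro!: sum.cong)
    then show ?L by blast
  qed
qed

theorem theorem2:
  fixes M :: "nat \<Rightarrow> real" and e E :: "complex \<Rightarrow> complex" and m :: "nat \<Rightarrow> real"
    and n k :: nat and A :: "complex mat" and ev :: "nat \<Rightarrow> complex" and mu :: "nat \<Rightarrow> nat"
  assumes "strongly_regular M"
    and "\<exists>\<rho>. nonzero_proximate_order \<rho> \<and> admits_proximate_order M \<rho>"
    and "kernel_pair M e E"
    and "is_moment_sequence e m"
    and "1 \<le> n" and "A \<in> carrier_mat n n"
    and "1 \<le> k" and "k \<le> n"
    and "inj_on ev {1..k}" and "ev ` {1..k} = {a. eigenvalue A a}"
    and "\<And>j. j \<in> {1..k} \<Longrightarrow> 1 \<le> mu j \<and> order (ev j) (char_poly A) = mu j"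
  shows "(\<exists>bs P Q. jordan_decomposition A bs P Q) \<and>
    (\<forall>bs P Q. jordan_decomposition A bs P Q \<longrightarrow>
      (\<forall>j\<in>{1..k}. \<forall>p\<in>{1..mu j}.
        (\<forall>z. jordan_solution m bs P (ev j) p z \<in> carrier_vec n) \<and>
        (\<forall>i<n. (\<lambda>z. vec_index (jordan_solution m bs P (ev j) p z) i) holomorphic_on UNIV)) \<and>
      (\<forall>U y. open U \<and> connected U \<and> 0 \<in> U \<and> (\<forall>z\<in>U. y z \<in> carrier_vec n) \<and>
          (\<forall>i<n. (\<lambda>z. vec_index (y z) i) holomorphic_on U) \<longrightarrow>
        (solves_moment_system m A y \<longleftrightarrow>
          (\<exists>C :: nat \<Rightarrow> nat \<Rightarrow> complex. \<forall>z\<in>U. \<forall>i<n.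
            vec_index (y z) i =
              (\<Sum>j=1..k. \<Sum>p=1..mu j. C j p * vec_index (jordan_solution m bs P (ev j) p z) i)))))"
proof -
  interpret entire_kernel m
    using assms(3,4) by (rule kernel_pair_imp_entire_kernel)
  note A = assms(6)
  show ?thesis
  proof (intro conjI allI impI ballI jordan_decomposition_exists[OF A])
    fix bs P Q
    assume "jordan_decomposition A bs P Q"
    then have wit: "similar_mat_wit A (jordan_matrix bs) P Q"
      by (simp add: jordan_decomposition_def)
    note w = similar_mat_witD2[OF A wit]
    have dim: "n = sum_list (map fst bs)" using w(5) by auto
    have cp: "char_poly (jordan_matrix bs) = char_poly A"
      using char_poly_similar wit by (metis similar_mat_def)
    let ?col = "\<lambda>(j, p). jordan_columns bs (ev j) ! (p - 1)"
    have bij: "bij_betw ?col (SIGMA j:{1..k}. {1..mu j}) {..<n}"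
      using bij_betw_jordan_columns[of ev k bs mu] assms(9-11) dim
      by (simp add: cp flip: eigenvalue_root_char_poly[OF A])
    have index: "vec_index (jordan_solution m bs P (ev j) p z) i
        = (P * kernel_jordan_matrix m bs z) $$ (i, ?col (j, p))"
      if "i < n" "j \<in> {1..k}" "p \<in> {1..mu j}" for i j p z
      using bij_betwE[OF bij] that w(6) dim by (auto simp: jordan_solution_def)
    {
      fix j p
      assume jp: "j \<in> {1..k}" "p \<in> {1..mu j}"
      show "jordan_solution m bs P (ev j) p z \<in> carrier_vec n" for z
        using w(6) by (auto simp: jordan_solution_def intro!: carrier_vecI)
      fix i assume i: "i < n"
      have "?col (j, p) < n" using bij_betwE[OF bij] jp by auto
      then show "(\<lambda>z. vec_index (jordan_solution m bs P (ev j) p z) i) holomorphic_on UNIV"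
        unfolding index[OF i jp] by (rule fundamental_matrix_entry_holomorphic[OF w(6) dim i])
    }
    fix U :: "complex set" and y
    assume *: "open U \<and> connected U \<and> 0 \<in> U \<and> (\<forall>z\<in>U. y z \<in> carrier_vec n) \<and>
        (\<forall>i<n. (\<lambda>z. vec_index (y z) i) holomorphic_on U)"
    have "solves_moment_system m A y \<longleftrightarrow>
        (\<exists>d. \<forall>z\<in>U. \<forall>i<n. vec_index (y z) i =
           (\<Sum>c<n. d c * (P * kernel_jordan_matrix m bs z) $$ (i, c)))"
      using * by (intro solves_moment_system_iff_combination[OF A wit]) auto
    also have "\<dots> \<longleftrightarrow> (\<exists>C. \<forall>z\<in>U. \<forall>i<n. vec_index (y z) i =
        (\<Sum>j=1..k. \<Sum>p=1..mu j. C j p * (P * kernel_jordan_matrix m bs z) $$ (i, ?col (j, p))))"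
      by (rule ex_coefficients_reindex[OF bij])
    also have "\<dots> \<longleftrightarrow> (\<exists>C. \<forall>z\<in>U. \<forall>i<n. vec_index (y z) i =
        (\<Sum>j=1..k. \<Sum>p=1..mu j. C j p * vec_index (jordan_solution m bs P (ev j) p z) i))"
    proof -
      have "(\<Sum>j=1..k. \<Sum>p=1..mu j. C j p * (P * kernel_jordan_matrix m bs z) $$ (i, ?col (j, p)))
        = (\<Sum>j=1..k. \<Sum>p=1..mu j. C j p * vec_index (jordan_solution m bs P (ev j) p z) i)"
        if "i < n" for C z i
        using index[OF that] by (intro sum.cong refl) simp
      then show ?thesis
        by (intro ex_cong1 ball_cong refl all_cong1 imp_cong) simp
    qed
    finally show "solves_moment_system m A y \<longleftrightarrow>
          (\<exists>C :: nat \<Rightarrow> nat \<Rightarrow> complex. \<forall>z\<in>U. \<forall>i<n.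
            vec_index (y z) i =
              (\<Sum>j=1..k. \<Sum>p=1..mu j. C j p * vec_index (jordan_solution m bs P (ev j) p z) i))" .
  qed
qed

end
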